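(* Let $n\equiv0\pmod 2$. The solutions $X\in M_n(\mathbb{C})$ of $X^tA_n+A_nX=0$ are exactly the matrices of the following form, for arbitrary parameters $x_0,x_1,\dots,x_{(n-2)/2}\in\mathbb{C}$: - $X_{ii}=x_0$ for $i$ odd and $X_{ii}=-x_0$ for $i$ even; - $X_{ij}=x_{(j-i)/2}$ for $i,j$ both odd, $i<j$; - $X_{ij}=-x_{(i-j)/2}$ for $i,j$ both even, $i>j$; - $X_{ij}=0$ in all other cases.
   Context: $A_n$ is the $n\times n$ matrix with $(A_n)_{i,i+1}=1$ for $1\le i\le n-1$ and all other entries $0$. *)

theory Defs
  imports Complex_Main "Jordan_Normal_Form.Matrix"
begin

text \<open>
  Matrix indices start at 0 in the library; in both definitions below,
  \<open>i\<close> and \<open>j\<close> are the mathematical indices, running over \<open>1, \<dots>, n\<close>.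
\<close>

definition A_mat :: "nat \<Rightarrow> complex mat" where
  "A_mat n = mat n n (\<lambda>(r, c). let i = r + 1; j = c + 1 in if j = i + 1 then 1 else 0)"

text \<open>
  The parameters \<open>x\<^sub>0, \<dots>, x\<^bsub>(n-2)/2\<^esub>\<close> form a vector \<open>x\<close> of dimension \<open>n div 2\<close>
  (for even \<open>n\<close>), whose entries are again counted from 0.
\<close>

definition sol_mat :: "nat \<Rightarrow> complex vec \<Rightarrow> complex mat" where
  "sol_mat n x = mat n n (\<lambda>(r, c). let i = r + 1; j = c + 1 in
     if i = j then (if odd i then x $ 0 else - x $ 0)
     else if odd i \<and> odd j \<and> i < j then x $ ((j - i) div 2)
     else if even i \<and> even j \<and> i > j then - x $ ((i - j) div 2)
     else 0)"

end

theory Submission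
  imports Defs
begin

text \<open>
  With indices counted from 0, the equation says that \<open>X (a + 1, c + 1) = - X (c, a)\<close> and that
  column \<open>0\<close> and column \<open>n - 1\<close> vanish off the diagonal.  Applying the relation twice, \<open>X\<close> is
  invariant under translation by \<open>(2, 2)\<close>, so every entry can be moved to the border:
  an entry below the diagonal in an even column goes down to column \<open>0\<close>, an entry above the
  diagonal in an odd column goes up to column \<open>n - 1\<close> (here \<open>n\<close> is even).  The remaining entries
  reduce by one use of the relation to these or to the entries \<open>X (0, 2 k)\<close>, which are free.
\<close>

lemma A_mat_carrier [simp]: "A_mat n \<in> carrier_mat n n"
  and dim_row_A_mat [simp]: "dim_row (A_mat n) = n"
  and dim_col_A_mat [simp]: "dim_col (A_mat n) = n"
  by (simp_all add: A_mat_def)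

lemma mult_A_mat_index:
  assumes Y: "Y \<in> carrier_mat n n" and r: "r < n" and c: "c < n"
  shows "(Y * A_mat n) $$ (r, c) = (if c = 0 then 0 else Y $$ (r, c - 1))"
proof -
  have "(Y * A_mat n) $$ (r, c) = (\<Sum>k = 0..<n. Y $$ (r, k) * (if c = k + 1 then 1 else 0))"
    using assms by (simp add: A_mat_def scalar_prod_def)
  also have "\<dots> = (\<Sum>k = 0..<n. if k = c - 1 then (if c = 0 then 0 else Y $$ (r, k)) else 0)"
    by (intro sum.cong) auto
  also have "\<dots> = (if c = 0 then 0 else Y $$ (r, c - 1))"
    using c by (simp add: sum.delta)
  finally show ?thesis .
qed

lemma A_mat_mult_index:
  assumes X: "X \<in> carrier_mat n n" and r: "r < n" and c: "c < n"
  shows "(A_mat n * X) $$ (r, c) = (if r + 1 < n then X $$ (r + 1, c) else 0)"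
proof -
  have "(A_mat n * X) $$ (r, c) = (\<Sum>k = 0..<n. (if k = r + 1 then 1 else 0) * X $$ (k, c))"
    using assms by (simp add: A_mat_def scalar_prod_def)
  also have "\<dots> = (\<Sum>k = 0..<n. if k = r + 1 then X $$ (k, c) else 0)"
    by (intro sum.cong) auto
  also have "\<dots> = (if r + 1 < n then X $$ (r + 1, c) else 0)"
    by (simp add: sum.delta)
  finally show ?thesis .
qed

text \<open>Multiplying by \<open>A_mat n\<close> on the right shifts columns one place right; on
  the left it shifts rows one place up. The conditionals mark the borders where zeros enter: the
  first column and the last row.\<close>

lemma transpose_A_mat_equation_iff:
  assumes X: "X \<in> carrier_mat n n"
  shows "transpose_mat X * A_mat n + A_mat n * X = 0\<^sub>m n n \<longleftrightarrow>
    (\<forall>r<n. \<forall>c<n. (if c = 0 then 0 else X $$ (c - 1, r)) +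
      (if r + 1 < n then X $$ (r + 1, c) else 0) = 0)" (is "?M = _ \<longleftrightarrow> ?R")
proof -
  have carrier: "transpose_mat X * A_mat n \<in> carrier_mat n n" "A_mat n * X \<in> carrier_mat n n"
    using X by (auto intro!: mult_carrier_mat[where n = n])
  have "?M = 0\<^sub>m n n \<longleftrightarrow> (\<forall>r<n. \<forall>c<n. ?M $$ (r, c) = 0)"
    using carrier by (auto simp: mat_eq_iff)
  also have "\<dots> \<longleftrightarrow> (\<forall>r<n. \<forall>c<n. (transpose_mat X * A_mat n) $$ (r, c)
      + (A_mat n * X) $$ (r, c) = 0)"
    using X by (simp del: index_mult_mat(1))
  also have "\<dots> \<longleftrightarrow> ?R"
    using X by (simp add: mult_A_mat_index A_mat_mult_index del: index_mult_mat)
  finally show ?thesis .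
qed

lemma sol_mat_solution:
  assumes "even n"
  shows "transpose_mat (sol_mat n x) * A_mat n + A_mat n * sol_mat n x = 0\<^sub>m n n"
proof -
  have "(if c = 0 then 0 else sol_mat n x $$ (c - 1, r)) +
      (if r + 1 < n then sol_mat n x $$ (r + 1, c) else 0) = 0" if "r < n" "c < n" for r c
  proof (cases c)
    case 0
    then show ?thesis using that by (simp add: sol_mat_def)
  next
    case (Suc d)
    show ?thesis
    proof (cases "r + 1 < n")
      case True
      then show ?thesis using that Suc by (auto simp: sol_mat_def)
    next
      case False
      then have "r = n - 1" using that by simp
      \<comment> \<open>What remains is an entry of column \<open>n - 1\<close> above the diagonal.
        Its mathematical column index is \<open>n\<close>, which is even, so it vanishes.\<close>
      then show ?thesis using that Suc assms by (auto simp: sol_mat_def)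
    qed
  qed
  then show ?thesis
    by (subst transpose_A_mat_equation_iff) (auto simp: sol_mat_def)
qed

lemma solution_eq_sol_mat:
  assumes "even n" and X: "X \<in> carrier_mat n n"
    and eq: "transpose_mat X * A_mat n + A_mat n * X = 0\<^sub>m n n"
  shows "X = sol_mat n (vec (n div 2) (\<lambda>k. X $$ (0, 2 * k)))"
proof -
  have R: "(if c = 0 then 0 else X $$ (c - 1, r)) +
      (if r + 1 < n then X $$ (r + 1, c) else 0) = 0" if "r < n" "c < n" for r c
    using eq that X by (simp add: transpose_A_mat_equation_iff)
  \<comment> \<open>On each border one summand of \<open>R\<close> drops out, so the other is
    zero.\<close>
  have col_first: "X $$ (a, 0) = 0" if "0 < a" "a < n" for a
    using R[of "a - 1" 0] that by simp
  have col_last: "X $$ (a, n - 1) = 0" if "a + 1 < n" for a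
    using R[of "n - 1" "a + 1"] that by simp
  have flip: "X $$ (a + 1, c + 1) = - X $$ (c, a)" if "a + 1 < n" "c + 1 < n" for a c
    using R[of a "c + 1"] that by (simp add: add_eq_0_iff)
  have shift: "X $$ (a + 2 * k, c + 2 * k) = X $$ (a, c)"
    if "a + 2 * k < n" "c + 2 * k < n" for a c k
    using that
  proof (induction k)
    case (Suc k)
    have "X $$ (a + 2 * Suc k, c + 2 * Suc k) = X $$ (a + 2 * k, c + 2 * k)"
      using flip[of "a + 2 * k + 1" "c + 2 * k + 1"] flip[of "c + 2 * k" "a + 2 * k"] Suc.prems
      by simp
    with Suc show ?case by simp
  qed simp
  have below: "X $$ (a, c) = 0" if "even c" "c < a" "a < n" for a c
    using shift[of "a - c" "c div 2" 0] col_first[of "a - c"] that by simp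
  have above: "X $$ (a, c) = 0" if "odd c" "a < c" "c < n" for a c
  proof -
    \<comment> \<open>Both \<open>c\<close> and \<open>n - 1\<close> are odd, so a diagonal
      translation by an even amount reaches the last column.\<close>
    have "even (n - 1 - c)" using that \<open>even n\<close> by simp
    then have "2 * ((n - 1 - c) div 2) = n - 1 - c" by simp
    then show ?thesis
      using shift[of a "(n - 1 - c) div 2" c] col_last[of "a + (n - 1 - c)"] that by simp
  qed
  have free: "X $$ (a, c) = X $$ (0, 2 * ((c - a) div 2))" if "even a" "even c" "a \<le> c" "c < n" for a c
    using shift[of 0 "a div 2" "c - a"] that by simp
  have flip': "X $$ (a, c) = - X $$ (c - 1, a - 1)" if "0 < a" "a < n" "0 < c" "c < n" for a c
    using flip[of "a - 1" "c - 1"] that by simp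
  show ?thesis
  proof (rule eq_matI)
    fix a c
    assume "a < dim_row (sol_mat n (vec (n div 2) (\<lambda>k. X $$ (0, 2 * k))))"
      and "c < dim_col (sol_mat n (vec (n div 2) (\<lambda>k. X $$ (0, 2 * k))))"
    then have ac: "a < n" "c < n" by (auto simp: sol_mat_def)
    \<comment> \<open>This keeps the parameter indices inside the vector, so that its entries can be
      evaluated.\<close>
    have bound: "k div 2 < n div 2" if "k < n" for k
      using that \<open>even n\<close> by presburger
    have b0: "0 < n div 2" using bound[of 0] ac by simp
    consider "a = c" | "a < c" | "c < a" by linarith
    then show "X $$ (a, c) = sol_mat n (vec (n div 2) (\<lambda>k. X $$ (0, 2 * k))) $$ (a, c)"
    proof cases
      case 1
      then show ?thesis
        using ac b0 free[of a a] flip'[of a a] free[of "a - 1" "a - 1"]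
        by (cases "even a") (auto simp: sol_mat_def odd_pos)
    next
      case 2
      then have "a - 1 < c - 1" if "odd a"
        using that by (intro diff_less_mono) (auto simp: odd_pos Suc_le_eq)
      \<comment> \<open>Even \<open>a\<close> and \<open>c\<close> give a parameter by
        \<open>free\<close>, and odd \<open>c\<close> gives zero by \<open>above\<close>. For odd
        \<open>a\<close> and even \<open>c\<close>, \<open>flip'\<close> leads to an entry below the
        diagonal in an even column.\<close>
      then show ?thesis
        using 2 ac bound[of "c - a"] free[of a c] above[of c a] flip'[of a c] below[of "a - 1" "c - 1"]
        by (cases "even a"; cases "even c") (auto simp: sol_mat_def odd_pos)
    next
      case 3
      then have "c - 1 < a - 1" if "odd c"
        using that by (intro diff_less_mono) (auto simp: odd_pos Suc_le_eq)
      \<comment> \<open>For odd \<open>c\<close>, \<open>flip'\<close> leads above the diagonal: to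
        a negated parameter if \<open>a\<close> is odd, to zero by \<open>above\<close> if
        \<open>a\<close> is even.\<close>
      then show ?thesis
        using 3 ac bound[of "a - c"] below[of c a] flip'[of a c] above[of "a - 1" "c - 1"]
          free[of "c - 1" "a - 1"]
        by (cases "even a"; cases "even c") (auto simp: sol_mat_def odd_pos)
    qed
  qed (use X in \<open>auto simp: sol_mat_def\<close>)
qed

theorem lemma4p3:
  fixes n :: nat
  assumes "even n"
  shows "{X \<in> carrier_mat n n. transpose_mat X * A_mat n + A_mat n * X = 0\<^sub>m n n}
       = {sol_mat n x | x. x \<in> carrier_vec (n div 2)}"
proof (intro equalityI subsetI)
  fix X
  assume "X \<in> {X \<in> carrier_mat n n. transpose_mat X * A_mat n + A_mat n * X = 0\<^sub>m n n}"
  then have "X = sol_mat n (vec (n div 2) (\<lambda>k. X $$ (0, 2 * k)))"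
    using solution_eq_sol_mat[OF assms] by blast
  then show "X \<in> {sol_mat n x | x. x \<in> carrier_vec (n div 2)}"
    using vec_carrier by blast
next
  fix X
  assume "X \<in> {sol_mat n x | x. x \<in> carrier_vec (n div 2)}"
  then obtain x where "X = sol_mat n x" by blast
  then show "X \<in> {X \<in> carrier_mat n n. transpose_mat X * A_mat n + A_mat n * X = 0\<^sub>m n n}"
    using sol_mat_solution[OF assms] by (simp add: sol_mat_def)
qed

end
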